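(* Let $S,R$ be sets of the form $S=C\cup\{c_1,c_2\}$ and $R=D\cup\{d_1,d_2\}$, where $C,D$ are circles in the plane $\mathbb R^2$, $c_1,c_2$ are distinct points from the interior of $C$, and $d_1,d_2$ are distinct points from the interior of $D$. Then the sets $S$ and $R$ are betweenness isomorphic.
   Context: For $a,b\in\mathbb R^2$, $[a,b]$ is the closed segment and $(a,b)=[a,b]\setminus\{a,b\}$ the open segment (empty if $a=b$). A betweenness isomorphism of sets $S,R\subset\mathbb R^2$ is a bijection $f\colon S\to R$ such that for all $a,b,c\in S$: $c\in(a,b)\iff f(c)\in(f(a),f(b))$. $S$ and $R$ are betweenness isomorphic if there exists a betweenness isomorphism of $S$ and $R$. *)

theory Defs
  imports "HOL-Analysis.Analysis"
begin

definition betweenness_isomorphism ::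
    "(real ^ 2 \<Rightarrow> real ^ 2) \<Rightarrow> (real ^ 2) set \<Rightarrow> (real ^ 2) set \<Rightarrow> bool" where
  "betweenness_isomorphism f S R \<longleftrightarrow>
     bij_betw f S R \<and>
     (\<forall>a\<in>S. \<forall>b\<in>S. \<forall>c\<in>S. c \<in> open_segment a b \<longleftrightarrow> f c \<in> open_segment (f a) (f b))"

definition betweenness_isomorphic :: "(real ^ 2) set \<Rightarrow> (real ^ 2) set \<Rightarrow> bool" where
  "betweenness_isomorphic S R \<longleftrightarrow> (\<exists>f. betweenness_isomorphism f S R)"

end

theory Submission
  imports Defs
begin

text \<open>
  A point of a circle is never strictly between two points of the closed disc, so only the chords
  through the two interior points matter. Let the line through these points meet the circle in
  a pole and an opposite point. Projecting the circle from the pole onto a line, with the opposite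
  point at \<open>0\<close> and the pole at infinity, turns the two chord involutions into
  \<open>x \<mapsto> - k / x\<close> and \<open>x \<mapsto> - l / x\<close> for some \<open>k > l > 0\<close>.
  A map \<open>x \<mapsto> sgn x * A * \<bar>x\<bar> powr \<alpha>\<close> conjugates such a pair \<open>(k, l)\<close> to any other
  pair \<open>(k', l')\<close>.
\<close>

section \<open>Combinatorial model of betweenness on labels\<close>

text \<open>
  \<open>Pt x\<close> is the point of the circle with projection \<open>x\<close>; along the common chord the
  order is \<open>Pole\<close>, \<open>Inner1\<close>, \<open>Inner2\<close>, \<open>Pt 0\<close>.
\<close>

datatype label = Pole | Pt real | Inner1 | Inner2

text \<open>The graph of the involution \<open>x \<mapsto> - k / x\<close> on the projective line,
  with \<open>Pole\<close> as infinity; hence \<open>Pole\<close> is paired with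
  \<open>Pt 0\<close>.\<close>

fun chord :: "real \<Rightarrow> label \<Rightarrow> label \<Rightarrow> bool" where
  "chord k (Pt x) (Pt y) \<longleftrightarrow> x * y = - k"
| "chord k Pole (Pt x) \<longleftrightarrow> x = 0"
| "chord k (Pt x) Pole \<longleftrightarrow> x = 0"
| "chord k _ _ \<longleftrightarrow> False"

text \<open>No circle label occurs as \<open>c\<close>, by strict convexity. The two explicit pairs
  are the segments with an inner endpoint; they lie on the common chord.\<close>

definition between :: "real \<Rightarrow> real \<Rightarrow> label \<Rightarrow> label \<Rightarrow> label \<Rightarrow> bool" where
  "between k l a b c \<longleftrightarrow>
     c = Inner1 \<and> (chord k a b \<or> {a, b} = {Pole, Inner2}) \<or>
     c = Inner2 \<and> (chord l a b \<or> {a, b} = {Pt 0, Inner1})"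

section \<open>Positive dependence of homogeneous vectors\<close>

text \<open>
  A projective map sends the circle to the parabola \<open>w = t\<^sup>2\<close> in the chart \<open>(w, 1, t)\<close>,
  with the pole as its point at infinity. All these vectors represent their points with positive
  weight, so betweenness becomes linear dependence with positive coefficients.
\<close>
fun hom_coords :: "real \<Rightarrow> real \<Rightarrow> label \<Rightarrow> real \<times> real \<times> real" where
  "hom_coords k l Pole = (1, 0, 0)"
| "hom_coords k l (Pt t) = (t\<^sup>2, 1, t)"
| "hom_coords k l Inner1 = (k, 1, 0)"
| "hom_coords k l Inner2 = (l, 1, 0)"

definition pos_comb :: "'a::real_vector \<Rightarrow> 'a \<Rightarrow> 'a \<Rightarrow> bool" where
  "pos_comb a b c \<longleftrightarrow> (\<exists>\<alpha>>0. \<exists>\<beta>>0. c = \<alpha> *\<^sub>R a + \<beta> *\<^sub>R b)"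

lemma pos_comb_commute: "pos_comb a b c \<longleftrightarrow> pos_comb b a c"
  unfolding pos_comb_def by (metis add.commute)

text \<open>The chord of the parabola \<open>w = t\<^sup>2\<close> through the parameters
  \<open>x\<close> and \<open>y\<close> meets the axis \<open>t = 0\<close> at
  \<open>w = - x * y\<close>, and strictly between its ends exactly when \<open>x\<close> and
  \<open>y\<close> have opposite signs.\<close>

lemma pos_comb_parabola:
  fixes k x y :: real
  assumes "0 < k"
  shows "pos_comb (x\<^sup>2, 1::real, x) (y\<^sup>2, 1, y) (k, 1, 0) \<longleftrightarrow> x * y = - k"
proof
  assume "pos_comb (x\<^sup>2, 1::real, x) (y\<^sup>2, 1, y) (k, 1, 0)"
  then obtain \<alpha> \<beta> where "k = \<alpha> * x\<^sup>2 + \<beta> * y\<^sup>2" "1 = \<alpha> + \<beta>" "0 = \<alpha> * x + \<beta> * y"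
    by (auto simp: pos_comb_def)
  then show "x * y = - k" by algebra
next
  assume xy: "x * y = - k"
  then have ne: "x - y \<noteq> 0" using assms by (smt (verit) zero_le_square)
  \<comment> \<open>The weights are the solution of \<open>\<alpha> + \<beta> = 1\<close>,
    \<open>\<alpha> * x + \<beta> * y = 0\<close>; opposite signs of \<open>x\<close> and
    \<open>y\<close> make both positive.\<close>
  have "x * y < 0" using xy assms by simp
  then have pos: "0 < - y / (x - y)" "0 < x / (x - y)"
    by (auto simp: mult_less_0_iff zero_less_divide_iff divide_less_0_iff)
  moreover have "- y / (x - y) + x / (x - y) = 1" "- y / (x - y) * x + x / (x - y) * y = 0"
    using ne by (simp_all add: divide_simps)
  moreover have "- y * x\<^sup>2 + x * y\<^sup>2 = - (x * y) * (x - y)"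
    by algebra
  then have "(- y * x\<^sup>2 + x * y\<^sup>2) / (x - y) = - (x * y)"
    using ne by simp
  then have "- y / (x - y) * x\<^sup>2 + x / (x - y) * y\<^sup>2 = k"
    using xy by (simp add: add_divide_distrib diff_divide_distrib)
  ultimately have "(k, 1::real, 0) = (- y / (x - y)) *\<^sub>R (x\<^sup>2, 1, x) + (x / (x - y)) *\<^sub>R (y\<^sup>2, 1, y)"
    by simp
  with pos show "pos_comb (x\<^sup>2, 1::real, x) (y\<^sup>2, 1, y) (k, 1, 0)"
    unfolding pos_comb_def by blast
qed

text \<open>Two parabola points are covered by the chord computation; every other pair contains
  \<open>Pole\<close> or an inner label and reduces to order on the axis \<open>t = 0\<close>. The
  condition \<open>a \<noteq> b\<close> is needed because a vector is a positive combination of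
  itself with itself.\<close>

lemma between_iff_pos_comb:
  assumes "0 < l" "l < k" "c = Inner1 \<or> c = Inner2"
  shows "between k l a b c \<longleftrightarrow>
    a \<noteq> b \<and> pos_comb (hom_coords k l a) (hom_coords k l b) (hom_coords k l c)"
proof -
  have k: "0 < k" using assms by simp
  \<comment> \<open>The middle coordinate forces coefficient 1 on the finite point, so the pole
    merely adds a positive amount to \<open>w\<close>.\<close>
  have pole: "pos_comb (1, 0, 0) (w, 1::real, t) (m, 1, 0) \<longleftrightarrow> t = 0 \<and> w < m" for w t m :: real
  proof
    assume "t = 0 \<and> w < m"
    then show "pos_comb (1, 0, 0) (w, 1::real, t) (m, 1, 0)"
      unfolding pos_comb_def
      by (intro exI[of _ "m - w"] conjI exI[of _ 1]) auto
  qed (auto simp: pos_comb_def)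
  have pole2: "\<not> pos_comb (1, 0, 0) (1, 0, 0) (m::real, 1::real, 0::real)" for m
    by (auto simp: pos_comb_def)
  \<comment> \<open>The middle coordinates make the coefficients sum to 1, so this is betweenness of
    numbers on the axis; the last disjunct is the degenerate case of equal vectors.\<close>
  have inner: "pos_comb (w, 1::real, t) (m, 1, 0) (m', 1, 0) \<longleftrightarrow>
      t = 0 \<and> (w < m' \<and> m' < m \<or> m < m' \<and> m' < w \<or> (w = m \<and> m = m'))"
    for w t m m' :: real
  proof
    assume "pos_comb (w, 1::real, t) (m, 1, 0) (m', 1, 0)"
    then obtain \<alpha> \<beta> where ab: "\<alpha> > 0" "\<beta> > 0" "\<alpha> + \<beta> = 1" "\<alpha> * w + \<beta> * m = m'" "t = 0"
      by (auto simp: pos_comb_def)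
    have \<beta>: "\<beta> = 1 - \<alpha>" using ab by simp
    have "m' - w = \<beta> * (m - w)" "m - m' = \<alpha> * (m - w)" using ab(4) unfolding \<beta> by (auto simp: algebra_simps)
    with ab show "t = 0 \<and> (w < m' \<and> m' < m \<or> m < m' \<and> m' < w \<or> (w = m \<and> m = m'))"
      by (smt (verit) mult_pos_pos mult_pos_neg mult_eq_0_iff)
  next
    assume R: "t = 0 \<and> (w < m' \<and> m' < m \<or> m < m' \<and> m' < w \<or> (w = m \<and> m = m'))"
    show "pos_comb (w, 1::real, t) (m, 1, 0) (m', 1, 0)"
    proof (cases "w = m")
      case True
      with R show ?thesis
        unfolding pos_comb_def
        by (auto intro!: exI[of _ "1/2::real"])
    next
      case False
      with R have "0 < (m - m') / (m - w)" "0 < (m' - w) / (m - w)"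
        by (auto simp: zero_less_divide_iff)
      moreover have "(m - m') / (m - w) + (m' - w) / (m - w) = 1"
        "(m - m') / (m - w) * w + (m' - w) / (m - w) * m = m'"
        using False by (simp_all add: divide_simps) (simp_all add: algebra_simps)
      then have "(m', 1::real, t) = ((m - m') / (m - w)) *\<^sub>R (w, 1, t) + ((m' - w) / (m - w)) *\<^sub>R (m, 1, 0)"
        using R by simp
      ultimately show ?thesis
        unfolding pos_comb_def using R by blast
    qed
  qed
  note inner' = inner[unfolded pos_comb_commute[of "(_, 1, _)" "(_, 1, 0)"]]
  note pole' = pole[unfolded pos_comb_commute[of "(1, 0, 0)"]]
  \<comment> \<open>Neither involution has a real fixed point, so \<open>chord\<close> never relates
    a label to itself.\<close>
  have sq: "x * x \<noteq> - k" "x * x \<noteq> - l" for x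
    using assms k zero_le_square[of x] by linarith+
  show ?thesis
    using assms k sq
    by (cases a; cases b)
      (auto simp: between_def pole pole' pole2 inner inner' pos_comb_parabola doubleton_eq_iff)
qed

text \<open>A pair \<open>(w, v)\<close> with \<open>w > 0\<close> represents the point
  \<open>p + v /\<^sub>R w\<close>. Changing between affine and homogeneous coefficients only
  multiplies them by quotients of weights, which preserves positivity.\<close>

lemma open_segment_weighted:
  fixes p :: "'a::real_vector"
  assumes "0 < wa" "0 < wb" "0 < wc"
  shows "p + vc /\<^sub>R wc \<in> open_segment (p + va /\<^sub>R wa) (p + vb /\<^sub>R wb) \<longleftrightarrow>
    p + va /\<^sub>R wa \<noteq> p + vb /\<^sub>R wb \<and> pos_comb (wa, va) (wb, vb) (wc, vc)"
proof -
  have "(\<exists>u. 0 < u \<and> u < 1 \<and> p + vc /\<^sub>R wc = (1 - u) *\<^sub>R (p + va /\<^sub>R wa) + u *\<^sub>R (p + vb /\<^sub>R wb))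
    \<longleftrightarrow> pos_comb (wa, va) (wb, vb) (wc, vc)" (is "?L \<longleftrightarrow> ?R")
  proof
    assume ?L
    then obtain u where u: "0 < u" "u < 1"
      "vc /\<^sub>R wc = (1 - u) *\<^sub>R (va /\<^sub>R wa) + u *\<^sub>R (vb /\<^sub>R wb)"
      by (auto simp: algebra_simps)
    have "vc = wc *\<^sub>R (vc /\<^sub>R wc)" using assms by simp
    also have "\<dots> = ((1 - u) * wc / wa) *\<^sub>R va + (u * wc / wb) *\<^sub>R vb"
      unfolding u(3) by (simp add: scaleR_add_right divide_inverse mult_ac)
    finally have "vc = ((1 - u) * wc / wa) *\<^sub>R va + (u * wc / wb) *\<^sub>R vb" .
    moreover have "(1 - u) * wc / wa * wa = (1 - u) * wc" "u * wc / wb * wb = u * wc"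
      using assms by simp_all
    then have "wc = (1 - u) * wc / wa * wa + u * wc / wb * wb"
      by (simp only:) (simp add: algebra_simps)
    ultimately have "(wc, vc) = ((1 - u) * wc / wa) *\<^sub>R (wa, va) + (u * wc / wb) *\<^sub>R (wb, vb)"
      by simp
    moreover have "(1 - u) * wc / wa > 0" "u * wc / wb > 0" using u assms by auto
    ultimately show ?R unfolding pos_comb_def by blast
  next
    assume ?R
    then obtain \<alpha> \<beta> where ab: "\<alpha> > 0" "\<beta> > 0" "wc = \<alpha> * wa + \<beta> * wb" "vc = \<alpha> *\<^sub>R va + \<beta> *\<^sub>R vb"
      by (auto simp: pos_comb_def)
    \<comment> \<open>The share of the total weight \<open>wc\<close> contributed by the second
      endpoint.\<close>
    define u where "u = \<beta> * wb / wc"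
    have u1: "1 - u = \<alpha> * wa / wc" using ab(3) assms by (simp add: u_def field_simps)
    have "0 < \<alpha> * wa / wc" "0 < u" using ab assms by (auto simp: u_def)
    then have "0 < u" "u < 1" using u1 by auto
    moreover have "vc /\<^sub>R wc = (1 - u) *\<^sub>R (va /\<^sub>R wa) + u *\<^sub>R (vb /\<^sub>R wb)"
      unfolding u1 unfolding u_def ab(4) using assms by (simp add: scaleR_add_right field_simps)
    then have "p + vc /\<^sub>R wc = (1 - u) *\<^sub>R (p + va /\<^sub>R wa) + u *\<^sub>R (p + vb /\<^sub>R wb)"
      by (simp add: algebra_simps)
    ultimately show ?L by blast
  qed
  then show ?thesis by (simp add: in_segment)
qed

section \<open>Geometry of a circle with two interior points\<close>

text \<open>A point strictly inside a segment is strictly closer to the centre than one of the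
  endpoints.\<close>

lemma sphere_notin_open_segment:
  fixes z :: "'a::euclidean_space"
  assumes "c \<in> sphere z r" "a \<in> cball z r" "b \<in> cball z r"
  shows "c \<notin> open_segment a b"
  using dist_decreases_open_segment[of c a b z] assms by (auto simp: dist_commute)

text \<open>The form \<open>n /\<^sub>R (k + 1)\<close> matches the vector \<open>(k, 1, 0)\<close>
  when its weight is the sum of the first two coordinates. Thus \<open>k\<close> and
  \<open>l\<close> are the ratios of the distances to the opposite point and to the pole.\<close>

lemma chord_endpoints:
  fixes m c1 c2 :: "'a::euclidean_space"
  assumes "c1 \<in> ball m r" "c2 \<in> ball m r" "c1 \<noteq> c2"
  obtains p n k l where "p \<in> sphere m r" "p + n \<in> sphere m r" "n \<noteq> 0" "0 < l" "l < k"
    "c1 = p + n /\<^sub>R (k + 1)" "c2 = p + n /\<^sub>R (l + 1)"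
proof -
  have "0 < r" using assms(1) by (metis ball_eq_empty empty_iff not_less)
  then have fr: "frontier (ball m r) = sphere m r" by simp
  obtain d where d: "0 < d" "c1 + d *\<^sub>R (c1 - c2) \<in> frontier (ball m r)"
    using ray_to_frontier[of "ball m r" c1 "c1 - c2"] assms by (auto simp: interior_open)
  obtain d' where d': "0 < d'" "c2 + d' *\<^sub>R (c2 - c1) \<in> frontier (ball m r)"
    using ray_to_frontier[of "ball m r" c2 "c2 - c1"] assms by (auto simp: interior_open)
  \<comment> \<open>In units of \<open>c2 - c1\<close>, the points \<open>p\<close>,
    \<open>c1\<close>, \<open>c2\<close>, \<open>p + n\<close> sit at \<open>0\<close>,
    \<open>d\<close>, \<open>1 + d\<close>, \<open>1 + d + d'\<close>, which gives the ratios
    \<open>(1 + d') / d\<close> and \<open>d' / (1 + d)\<close>.\<close>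
  define p where "p = c1 + d *\<^sub>R (c1 - c2)"
  define n where "n = (1 + d + d') *\<^sub>R (c2 - c1)"
  show ?thesis
  proof
    show "p \<in> sphere m r" using d fr p_def by simp
    have "p + n = c2 + d' *\<^sub>R (c2 - c1)" by (simp add: p_def n_def algebra_simps)
    then show "p + n \<in> sphere m r" using d' fr by simp
    show "n \<noteq> 0" using d d' assms by (simp add: n_def)
    show "0 < d' / (1 + d)" using d d' by simp
    show "d' / (1 + d) < (1 + d') / d" using d d' by (simp add: field_simps add_pos_pos)
    have "(1 + d + d') / ((1 + d') / d + 1) = d" using d d' by (simp add: field_simps)
    then have "n /\<^sub>R ((1 + d') / d + 1) = d *\<^sub>R (c2 - c1)"
      by (simp add: n_def divide_inverse mult.commute)
    then show "c1 = p + n /\<^sub>R ((1 + d') / d + 1)" by (simp add: p_def algebra_simps)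
    have "(1 + d + d') / (d' / (1 + d) + 1) = 1 + d" using d d' by (simp add: field_simps)
    then have "n /\<^sub>R (d' / (1 + d) + 1) = (1 + d) *\<^sub>R (c2 - c1)"
      by (simp add: n_def divide_inverse mult.commute)
    then show "c2 = p + n /\<^sub>R (d' / (1 + d) + 1)" by (simp add: p_def algebra_simps)
  qed
qed

text \<open>Applied to the radius vector at the pole, this supplies the tangent direction
  there.\<close>

lemma orthogonal_complement_plane:
  fixes m :: "real ^ 2"
  assumes "m \<noteq> 0"
  obtains e where "norm e = 1" "e \<bullet> m = 0" "\<And>v. v \<bullet> m = 0 \<Longrightarrow> \<exists>\<delta>. v = \<delta> *\<^sub>R e"
proof -
  \<comment> \<open>The quarter turn of \<open>m\<close>; \<open>\<delta>\<close> below is the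
    projection coefficient of \<open>v\<close> onto \<open>f\<close>.\<close>
  define f :: "real ^ 2" where "f = vector [- m $ 2, m $ 1]"
  have f: "f $ 1 = - m $ 2" "f $ 2 = m $ 1" by (simp_all add: f_def)
  have m0: "m $ 1 * m $ 1 + m $ 2 * m $ 2 \<noteq> 0"
    using assms by (simp add: sum_squares_eq_zero_iff vec_eq_iff forall_2)
  have f0: "f \<noteq> 0" using m0 f by auto
  show ?thesis
  proof
    show "norm (f /\<^sub>R norm f) = 1" using f0 by simp
    show "(f /\<^sub>R norm f) \<bullet> m = 0" by (simp add: inner_vec_def sum_2 f)
    fix v :: "real ^ 2" assume v: "v \<bullet> m = 0"
    define \<delta> where "\<delta> = (m $ 1 * v $ 2 - m $ 2 * v $ 1) / (m $ 1 * m $ 1 + m $ 2 * m $ 2)"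
    have "v $ 1 * m $ 1 + v $ 2 * m $ 2 = 0" using v by (simp add: inner_vec_def sum_2)
    then have "v $ 1 = \<delta> * f $ 1" "v $ 2 = \<delta> * f $ 2"
      using m0 unfolding \<delta>_def f by (simp_all add: field_simps) algebra+
    then have "v = \<delta> *\<^sub>R f" by (simp add: vec_eq_iff forall_2)
    then show "\<exists>\<delta>. v = \<delta> *\<^sub>R (f /\<^sub>R norm f)"
      using f0 by (intro exI[of _ "\<delta> * norm f"]) simp
  qed
qed

text \<open>\<open>Pt t\<close> becomes the second intersection of the circle with the line from the
  pole \<open>p\<close> in direction \<open>n + t *\<^sub>R e\<close>, where \<open>n\<close> spans
  the common chord and \<open>e\<close> the tangent at \<open>p\<close>. In homogeneous coordinates
  this is a linear map, so positive dependence carries over.\<close>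

lemma circle_labelling:
  fixes m c1 c2 :: "real ^ 2"
  assumes "c1 \<in> ball m r" "c2 \<in> ball m r" "c1 \<noteq> c2"
  obtains \<psi> k l where "0 < l" "l < k" "bij_betw \<psi> UNIV (sphere m r \<union> {c1, c2})"
    "\<And>a b c. \<psi> c \<in> open_segment (\<psi> a) (\<psi> b) \<longleftrightarrow> between k l a b c"
proof -
  obtain p n k l where p: "p \<in> sphere m r" "p + n \<in> sphere m r" "n \<noteq> 0"
    and kl: "0 < l" "l < k"
    and c: "c1 = p + n /\<^sub>R (k + 1)" "c2 = p + n /\<^sub>R (l + 1)"
    using chord_endpoints[OF assms] by metis
  \<comment> \<open>With the origin moved to \<open>p\<close> on the circle, its equation has no
    constant term.\<close>
  have sph: "p + v \<in> sphere m r \<longleftrightarrow> v \<bullet> v = 2 * (v \<bullet> (m - p))" for v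
  proof -
    have "p + v \<in> sphere m r \<longleftrightarrow> norm (v - (m - p)) = norm (m - p)"
      using p(1) by (simp add: dist_norm norm_minus_commute algebra_simps)
    also have "\<dots> \<longleftrightarrow> (v - (m - p)) \<bullet> (v - (m - p)) = (m - p) \<bullet> (m - p)"
      by (simp add: norm_eq)
    also have "\<dots> \<longleftrightarrow> v \<bullet> v = 2 * (v \<bullet> (m - p))"
      by (simp add: inner_diff_left inner_diff_right inner_commute) (auto simp: algebra_simps)
    finally show ?thesis .
  qed
  have nn: "n \<bullet> n = 2 * (n \<bullet> (m - p))" using p(2) sph by blast
  have nn0: "n \<bullet> n > 0" using p(3) by simp
  then have "m - p \<noteq> 0" using nn by auto
  then obtain e0 where e0: "norm e0 = 1" "e0 \<bullet> (m - p) = 0"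
    "\<And>v. v \<bullet> (m - p) = 0 \<Longrightarrow> \<exists>\<delta>. v = \<delta> *\<^sub>R e0"
    using orthogonal_complement_plane by metis
  \<comment> \<open>Scaling to the length of \<open>n\<close> makes the coefficient of
    \<open>t\<^sup>2\<close> in \<open>sq\<close> equal to 1.\<close>
  define e where "e = norm n *\<^sub>R e0"
  have em: "e \<bullet> (m - p) = 0" using e0 by (simp add: e_def)
  have ee: "e \<bullet> e = n \<bullet> n" using e0(1) by (simp add: e_def dot_square_norm power2_eq_square)
  have e_dir: "\<exists>\<delta>. v = \<delta> *\<^sub>R e" if v: "v \<bullet> (m - p) = 0" for v
  proof -
    obtain \<delta> where "v = \<delta> *\<^sub>R e0" using e0(3)[OF v] by blast
    then show ?thesis using p(3) by (intro exI[of _ "\<delta> / norm n"]) (simp add: e_def)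
  qed
  \<comment> \<open>\<open>\<beta>\<close> records the angle between chord and tangent. On the
    parabola \<open>w = t\<^sup>2\<close>, the linear weight \<open>wt\<close> becomes
    \<open>t\<^sup>2 + 1 + \<beta> * t\<close>, exactly the divisor that puts
    \<open>n + t *\<^sub>R e\<close> on the circle.\<close>
  define \<beta> where "\<beta> = 2 * (n \<bullet> e) / (n \<bullet> n)"
  define wt where "wt = (\<lambda>(w, x, t). w + x + \<beta> * t)"
  define vc where "vc = (\<lambda>(w::real, x, t). x *\<^sub>R n + t *\<^sub>R e)"
  define h where "h = hom_coords k l"
  define \<psi> where "\<psi> = (\<lambda>a. p + vc (h a) /\<^sub>R wt (h a))"
  have indep: "x *\<^sub>R n + t *\<^sub>R e = x' *\<^sub>R n + t' *\<^sub>R e \<longleftrightarrow> x = x' \<and> t = t'" for x t x' t'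
  proof
    assume eq: "x *\<^sub>R n + t *\<^sub>R e = x' *\<^sub>R n + t' *\<^sub>R e"
    then have "(x *\<^sub>R n + t *\<^sub>R e) \<bullet> (m - p) = (x' *\<^sub>R n + t' *\<^sub>R e) \<bullet> (m - p)" by simp
    then have "x * (n \<bullet> (m - p)) = x' * (n \<bullet> (m - p))" by (simp add: inner_add_left em)
    then have "x = x'" using nn nn0 by auto
    moreover have "e \<noteq> 0" using ee nn0 by auto
    ultimately show "x = x' \<and> t = t'" using eq by auto
  qed auto
  have sq: "(n + t *\<^sub>R e) \<bullet> (n + t *\<^sub>R e) = (t\<^sup>2 + 1 + \<beta> * t) * (n \<bullet> n)" for t
    using nn0
    by (simp add: inner_add_left inner_add_right ee \<beta>_def inner_commute[of e n] field_simps power2_eq_square)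
  have quad_pos: "0 < t\<^sup>2 + 1 + \<beta> * t" for t
  proof -
    have "n + t *\<^sub>R e \<noteq> 0" using indep[of 1 t 0 0] by simp
    then have "0 < (n + t *\<^sub>R e) \<bullet> (n + t *\<^sub>R e)" by simp
    then show ?thesis unfolding sq using nn0 by (simp add: zero_less_mult_iff)
  qed
  have wt_pos: "0 < wt (h a)" for a
    using quad_pos kl by (cases a) (simp_all add: wt_def h_def)
  have \<psi>: "\<psi> Pole = p" "\<psi> Inner1 = c1" "\<psi> Inner2 = c2"
    "\<psi> (Pt t) = p + (n + t *\<^sub>R e) /\<^sub>R (t\<^sup>2 + 1 + \<beta> * t)" for t
    using c by (simp_all add: \<psi>_def h_def wt_def vc_def)
  have Pt_sphere: "\<psi> (Pt t) \<in> sphere m r" for t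
  proof -
    define W where "W = t\<^sup>2 + 1 + \<beta> * t"
    have "W > 0" using quad_pos W_def by simp
    moreover have "((n + t *\<^sub>R e) /\<^sub>R W) \<bullet> ((n + t *\<^sub>R e) /\<^sub>R W) = inverse W * (inverse W * (W * (n \<bullet> n)))"
      using sq[of t] unfolding W_def by simp
    moreover have "((n + t *\<^sub>R e) /\<^sub>R W) \<bullet> (m - p) = inverse W * (n \<bullet> (m - p))"
      by (simp add: inner_add_left em)
    ultimately show ?thesis unfolding \<psi> sph W_def[symmetric] using nn by simp
  qed
  have inj: "inj \<psi>"
  proof (rule injI)
    fix a b assume "\<psi> a = \<psi> b"
    then have eq: "vc (h a) /\<^sub>R wt (h a) = vc (h b) /\<^sub>R wt (h b)" by (simp add: \<psi>_def)
    have frac: "fst (snd (h a)) / wt (h a) = fst (snd (h b)) / wt (h b) \<and>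
      snd (snd (h a)) / wt (h a) = snd (snd (h b)) / wt (h b)"
      using eq indep[of "fst (snd (h a)) / wt (h a)" "snd (snd (h a)) / wt (h a)"
          "fst (snd (h b)) / wt (h b)" "snd (snd (h b)) / wt (h b)"]
      by (simp add: vc_def case_prod_beta scaleR_add_right divide_inverse mult.commute)
    define wa wb where "wa = wt (h a)" and "wb = wt (h b)"
    have w: "0 < wa" "0 < wb" using wt_pos by (simp_all add: wa_def wb_def)
    \<comment> \<open>This coordinate is 0 for \<open>Pole\<close> and 1 for all other labels, so
      equal quotients force equal coordinates and then equal weights.\<close>
    have "fst (snd (h a)) = fst (snd (h b))"
      using frac w unfolding wa_def[symmetric] wb_def[symmetric]
      by (cases a; cases b) (auto simp: h_def)
    moreover from this have "wa = wb"
      using frac w wa_def wb_def by (cases a; cases b) (auto simp: h_def wt_def)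
    ultimately have "snd (h a) = snd (h b)" "wt (h a) = wt (h b)"
      using frac w by (simp_all add: wa_def wb_def prod_eq_iff)
    then have "h a = h b" by (simp add: wt_def prod_eq_iff case_prod_beta)
    then show "a = b" using kl by (cases a; cases b) (auto simp: h_def)
  qed
  have range: "range \<psi> = sphere m r \<union> {c1, c2}"
  proof (intro equalityI subsetI)
    fix z assume "z \<in> range \<psi>"
    then obtain a where "z = \<psi> a" by blast
    then show "z \<in> sphere m r \<union> {c1, c2}"
      using Pt_sphere p(1) \<psi> by (cases a) auto
  next
    fix z assume z: "z \<in> sphere m r \<union> {c1, c2}"
    have "z \<in> range \<psi>" if zs: "z \<in> sphere m r" "z \<noteq> p"
    proof -
      define v where "v = z - p"
      have v: "v \<noteq> 0" "v \<bullet> v = 2 * (v \<bullet> (m - p))" using zs sph[of v] by (auto simp: v_def)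
      \<comment> \<open>Since \<open>e\<close> is orthogonal to \<open>m - p\<close>, pairing with
        \<open>m - p\<close> reads off the coefficient of \<open>n\<close> in \<open>v\<close>; the
        slope is then \<open>t = \<delta> / \<alpha>\<close>.\<close>
      define \<alpha> where "\<alpha> = v \<bullet> (m - p) / (n \<bullet> (m - p))"
      have "(v - \<alpha> *\<^sub>R n) \<bullet> (m - p) = 0"
        using nn nn0 by (simp add: inner_diff_left \<alpha>_def)
      then obtain \<delta> where \<delta>: "v - \<alpha> *\<^sub>R n = \<delta> *\<^sub>R e" using e_dir by blast
      have vv: "v \<bullet> v = \<alpha> * (n \<bullet> n)" using v nn nn0 by (simp add: \<alpha>_def field_simps)
      have "v \<bullet> v > 0" using v(1) by simp
      then have \<alpha>: "\<alpha> > 0" using nn0 vv by (simp add: zero_less_mult_iff)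
      define t where "t = \<delta> / \<alpha>"
      define W where "W = t\<^sup>2 + 1 + \<beta> * t"
      have W: "W > 0" using quad_pos W_def by simp
      have veq: "v = \<alpha> *\<^sub>R (n + t *\<^sub>R e)" using \<delta> \<alpha> by (simp add: t_def algebra_simps)
      \<comment> \<open>Two evaluations of \<open>v \<bullet> v\<close>, by \<open>sq\<close> and by
        the circle equation, fix the scale \<open>\<alpha>\<close>.\<close>
      have "\<alpha> * (\<alpha> * (W * (n \<bullet> n))) = \<alpha> * (n \<bullet> n)"
        using vv sq[of t] unfolding veq W_def by simp
      then have "\<alpha> * W = 1" using \<alpha> nn0 by auto
      then have "\<alpha> = inverse W" using W by (simp add: field_simps)
      then have "z = \<psi> (Pt t)" unfolding \<psi> using veq by (simp add: v_def W_def algebra_simps)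
      then show ?thesis by simp
    qed
    then show "z \<in> range \<psi>" using z \<psi> by (metis UnE empty_iff insert_iff rangeI)
  qed
  have cball: "\<psi> a \<in> cball m r" for a
    using range assms ball_subset_cball sphere_cball
    by (smt (verit, best) UnE insert_iff empty_iff rangeI subsetD)
  have "\<psi> c \<in> open_segment (\<psi> a) (\<psi> b) \<longleftrightarrow> between k l a b c" for a b c
  proof (cases "c = Inner1 \<or> c = Inner2")
    case False
    then have "\<psi> c \<in> sphere m r" using Pt_sphere p(1) \<psi>(1) by (cases c) auto
    then show ?thesis
      using sphere_notin_open_segment[OF _ cball cball] False by (auto simp: between_def)
  next
    case True
    \<comment> \<open>\<open>A \<mapsto> (wt A, vc A)\<close> is linear, and injective because
      \<open>n\<close> and \<open>e\<close> are independent.\<close>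
    have "pos_comb (wt A, vc A) (wt B, vc B) (wt C, vc C) \<longleftrightarrow> pos_comb A B C" for A B C
    proof -
      have *: "(wt C, vc C) = \<alpha> *\<^sub>R (wt A, vc A) + \<gamma> *\<^sub>R (wt B, vc B)
        \<longleftrightarrow> C = \<alpha> *\<^sub>R A + \<gamma> *\<^sub>R B" (is "?L \<longleftrightarrow> ?R") for \<alpha> \<gamma>
      proof -
        obtain w1 x1 t1 w2 x2 t2 w x t where ABC: "A = (w1, x1, t1)" "B = (w2, x2, t2)" "C = (w, x, t)"
          by (metis prod_cases3)
        have "vc C = \<alpha> *\<^sub>R vc A + \<gamma> *\<^sub>R vc B \<longleftrightarrow> x = \<alpha> * x1 + \<gamma> * x2 \<and> t = \<alpha> * t1 + \<gamma> * t2"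
          using indep[of x t "\<alpha> * x1 + \<gamma> * x2" "\<alpha> * t1 + \<gamma> * t2"]
          by (simp add: ABC vc_def algebra_simps)
        then show ?thesis by (auto simp: ABC wt_def algebra_simps)
      qed
      show ?thesis unfolding pos_comb_def * ..
    qed
    then have "\<psi> c \<in> open_segment (\<psi> a) (\<psi> b) \<longleftrightarrow> \<psi> a \<noteq> \<psi> b \<and> pos_comb (h a) (h b) (h c)"
      unfolding \<psi>_def using open_segment_weighted wt_pos by metis
    also have "\<psi> a \<noteq> \<psi> b \<longleftrightarrow> a \<noteq> b" using inj by (simp add: inj_eq)
    finally show ?thesis using between_iff_pos_comb[OF kl True] by (simp add: h_def)
  qed
  with kl inj range show thesis by (intro that[of l k \<psi>]) (auto simp: bij_betw_def)
qed

section \<open>Conjugation of the chord involutions by signed powers\<close>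

text \<open>A signed power is multiplicative up to the constant \<open>B = A * A\<close>, so it
  carries product \<open>- j\<close> to product \<open>- (B * j powr \<alpha>)\<close>. The two
  parameters \<open>B\<close> and \<open>\<alpha>\<close> suffice to match both \<open>k\<close> and
  \<open>l\<close>.\<close>

lemma signed_power_conjugation:
  fixes k l k' l' :: real
  assumes "0 < l" "l < k" "0 < l'" "l' < k'"
  obtains g where "bij g" "g 0 = 0" "\<And>x y. g x * g y = - k' \<longleftrightarrow> x * y = - k"
    "\<And>x y. g x * g y = - l' \<longleftrightarrow> x * y = - l"
proof -
  \<comment> \<open>Dividing \<open>B * k powr \<alpha> = k'\<close> by
    \<open>B * l powr \<alpha> = l'\<close> determines \<open>\<alpha>\<close>, positive because
    both ratios exceed 1; the first equation then gives \<open>B\<close>.\<close>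
  define \<alpha> where "\<alpha> = ln (k' / l') / ln (k / l)"
  have \<alpha>: "\<alpha> > 0" using assms by (simp add: \<alpha>_def)
  define B where "B = k' / k powr \<alpha>"
  have B: "B > 0" "k' = B * k powr \<alpha>" using assms by (auto simp: B_def)
  have "(k / l) powr \<alpha> = k' / l'" using assms by (simp add: \<alpha>_def powr_def)
  then have lB: "l' = B * l powr \<alpha>" using assms by (simp add: B_def powr_divide field_simps)
  define A where "A = sqrt B"
  have A: "A > 0" "A * A = B" using B by (auto simp: A_def)
  define g where "g = (\<lambda>x. sgn x * (A * \<bar>x\<bar> powr \<alpha>))"
  have conj: "g x * g y = - (B * j powr \<alpha>) \<longleftrightarrow> x * y = - j" if j: "j > 0" for j x y
  proof -
    have "g x * g y = sgn (x * y) * (B * \<bar>x * y\<bar> powr \<alpha>)"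
      by (simp add: g_def sgn_mult abs_mult powr_mult A(2)[symmetric])
    moreover have "sgn z * (B * \<bar>z\<bar> powr \<alpha>) = - (B * j powr \<alpha>) \<longleftrightarrow> z = - j" for z
    proof (cases "z < 0")
      case True
      have "(- z) powr \<alpha> = j powr \<alpha> \<longleftrightarrow> - z = j"
        using True j \<alpha> powr_less_mono2[of \<alpha> "- z" j] powr_less_mono2[of \<alpha> j "- z"]
        by (cases "- z" j rule: linorder_cases) auto
      then show ?thesis using True B by auto
    next
      case False
      then have "sgn z * (B * \<bar>z\<bar> powr \<alpha>) \<ge> 0" using B by (simp add: sgn_if)
      moreover have "- (B * j powr \<alpha>) < 0" using B j by simp
      ultimately show ?thesis using False j by auto
    qed
    ultimately show ?thesis by simp
  qed
  have "bij g"
  proof (rule bijI')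
    define g' where "g' = (\<lambda>y. sgn y * (\<bar>y\<bar> / A) powr (1 / \<alpha>))"
    have 1: "g' (g x) = x" for x
      using A(1) \<alpha> by (auto simp: g_def g'_def abs_mult powr_powr sgn_if zero_less_mult_iff mult_less_0_iff)
    have 2: "g (g' y) = y" for y
      using A(1) \<alpha> by (auto simp: g_def g'_def abs_mult powr_powr sgn_if zero_less_mult_iff mult_less_0_iff)
    show "g x = g y \<longleftrightarrow> x = y" for x y using 1 by metis
    show "\<exists>x. y = g x" for y using 2 by metis
  qed
  moreover have "g 0 = 0" by (simp add: g_def)
  ultimately show thesis
    using conj[of k] conj[of l] assms B lB by (intro that[of g]) auto
qed

text \<open>\<open>between\<close> sees parameters only through the two product conditions and the
  test for \<open>0\<close>, all respected by \<open>g\<close>, so the remaining labels can stay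
  fixed.\<close>

lemma between_isomorphic:
  assumes "0 < l" "l < k" "0 < l'" "l' < k'"
  obtains \<phi> where "bij \<phi>" "\<And>a b c. between k' l' (\<phi> a) (\<phi> b) (\<phi> c) \<longleftrightarrow> between k l a b c"
proof -
  obtain g where g: "bij g" "g 0 = 0" "\<And>x y. g x * g y = - k' \<longleftrightarrow> x * y = - k"
    "\<And>x y. g x * g y = - l' \<longleftrightarrow> x * y = - l"
    using signed_power_conjugation[OF assms] by metis
  have g_inj: "g x = g y \<longleftrightarrow> x = y" for x y using g(1) by (simp add: bij_def inj_eq)
  have g_zero: "g x = 0 \<longleftrightarrow> x = 0" for x using g_inj[of x 0] g(2) by simp
  define \<phi> where "\<phi> = (\<lambda>a. case a of Pt x \<Rightarrow> Pt (g x) | _ \<Rightarrow> a)"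
  have "bij \<phi>"
  proof (rule bijI')
    show "\<phi> a = \<phi> b \<longleftrightarrow> a = b" for a b
      by (auto simp: \<phi>_def g_inj split: label.splits)
    show "\<exists>a. b = \<phi> a" for b
    proof (cases b)
      case (Pt y)
      obtain x where "y = g x" using g(1) by (metis bij_pointE)
      then show ?thesis using Pt by (intro exI[of _ "Pt x"]) (simp add: \<phi>_def)
    qed (auto simp: \<phi>_def intro: exI[of _ b])
  qed
  moreover have "between k' l' (\<phi> a) (\<phi> b) (\<phi> c) \<longleftrightarrow> between k l a b c" for a b c
    by (cases a; cases b; cases c)
      (auto simp: \<phi>_def between_def g g_zero doubleton_eq_iff)
  ultimately show thesis using that by blast
qed

section \<open>Transport of betweenness through the labels\<close>

theorem theorem4p3:
  fixes p q c1 c2 d1 d2 :: "real ^ 2" and r s :: real and C D S R :: "(real ^ 2) set"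
  assumes "r > 0" and "C = sphere p r"
    and "s > 0" and "D = sphere q s"
    and "c1 \<in> ball p r" and "c2 \<in> ball p r" and "c1 \<noteq> c2"
    and "d1 \<in> ball q s" and "d2 \<in> ball q s" and "d1 \<noteq> d2"
    and "S = C \<union> {c1, c2}" and "R = D \<union> {d1, d2}"
  shows "betweenness_isomorphic S R"
proof -
  obtain \<psi> k l where \<psi>: "0 < l" "l < k" "bij_betw \<psi> UNIV S"
    "\<And>a b c. \<psi> c \<in> open_segment (\<psi> a) (\<psi> b) \<longleftrightarrow> between k l a b c"
    using circle_labelling[of c1 p r c2] assms by metis
  obtain \<omega> k' l' where \<omega>: "0 < l'" "l' < k'" "bij_betw \<omega> UNIV R"
    "\<And>a b c. \<omega> c \<in> open_segment (\<omega> a) (\<omega> b) \<longleftrightarrow> between k' l' a b c"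
    using circle_labelling[of d1 q s d2] assms by metis
  obtain \<phi> where \<phi>: "bij \<phi>"
    "\<And>a b c. between k' l' (\<phi> a) (\<phi> b) (\<phi> c) \<longleftrightarrow> between k l a b c"
    using between_isomorphic[OF \<psi>(1,2) \<omega>(1,2)] by metis
  \<comment> \<open>Read off the label of a point of \<open>S\<close>, convert its parameter, and
    place it in \<open>R\<close>. As every point of \<open>S\<close> has a label, betweenness can be
    compared on labels alone.\<close>
  define f where "f = \<omega> \<circ> \<phi> \<circ> inv_into UNIV \<psi>"
  have f\<psi>: "f (\<psi> a) = \<omega> (\<phi> a)" for a
    using \<psi>(3) by (simp add: f_def bij_betw_def)
  have "bij_betw f S R"
    unfolding f_def using \<psi>(3) \<phi>(1) \<omega>(3)
    by (blast intro: bij_betw_trans bij_betw_inv_into)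
  moreover have "x \<in> range \<psi>" if "x \<in> S" for x
    using that \<psi>(3) by (simp add: bij_betw_def)
  then have "\<forall>a\<in>S. \<forall>b\<in>S. \<forall>c\<in>S. c \<in> open_segment a b \<longleftrightarrow> f c \<in> open_segment (f a) (f b)"
    using f\<psi> \<psi>(4) \<omega>(4) \<phi>(2) by (smt (verit, best) imageE)
  ultimately show ?thesis
    unfolding betweenness_isomorphic_def betweenness_isomorphism_def by blast
qed

end
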